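(* Let $n \ge 2$ and let $X = \{\sigma_{i_1},\ldots,\sigma_{i_k}\}$ be a nonempty subset of the set $A(B_n)=\{\sigma_1,\ldots,\sigma_{n-1}\}$ of atoms of the lattice $B_n$, where $1 \le i_1 < \cdots < i_k \le n-1$. Assume that $\bigvee X = \widehat{1}$ in $B_n$. Then, with respect to the total order $\sigma_1 \lhd \sigma_2 \lhd \cdots \lhd \sigma_{n-1}$, $X$ is NBB if and only if both of the following hold: (1) $i_1 = 1$; (2) $\{i_2-1, i_3-1, \ldots, i_k-1\}$ is a sparse set of $[n-2]$.
   Context: For $\sigma \in S_n$ let $\mathrm{Inv}(\sigma) = \{(i,j) : 1 \le i<j\le n,\ \sigma(i)>\sigma(j)\}$. The weak order on $S_n$ is defined by $\sigma \le \tau$ iff $\mathrm{Inv}(\sigma) \subseteq \mathrm{Inv}(\tau)$. $B'_n$ is the set of 321-avoiding permutations in $S_n$ (those with no $i<j<k$ such that $\sigma(i)>\sigma(j)>\sigma(k)$), with the order induced from the weak order; $B_n := B'_n \cup \{\widehat{1}\}$, where $\widehat{1}$ is a new element adjoined strictly above all elements of $B'_n$. $B_n$ is a finite lattice whose minimum is the identity permutation. Its atoms are the adjacent transpositions $\sigma_i := (i,i+1)$, $1 \le i \le n-1$. Given a total order $\lhd$ on the set of atoms of a finite lattice $L$, a nonempty set $D$ of atoms is bounded below (BB) if for every $d \in D$ there is an atom $a$ of $L$ with $a \lhd d$ (strictly) and $a < \bigvee D$ in $L$. A set $B$ of atoms is NBB if it does not contain any bounded below subset $D \subseteq B$. For $m\ge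 0$, $[m] = \{1,\ldots,m\}$ (with $[0]=\emptyset$). A subset $S \subseteq [m]$ is a sparse set if $1 \in S$ and, whenever $i \in S$ with $1 \le i \le m-1$, $i+1 \notin S$. In particular the empty set is not sparse. *)

theory Defs
  imports "HOL-Algebra.Lattice" "HOL-Combinatorics.Permutations"
begin

text \<open>Elements of \<open>S\<^sub>n\<close> are functions \<open>\<sigma> :: nat \<Rightarrow> nat\<close> with
  \<open>\<sigma> permutes {1..n}\<close>, i.e. bijections that fix every number outside \<open>{1..n}\<close>.\<close>

definition inversions :: "nat \<Rightarrow> (nat \<Rightarrow> nat) \<Rightarrow> (nat \<times> nat) set" where
  "inversions n \<sigma> = {(i, j). 1 \<le> i \<and> i < j \<and> j \<le> n \<and> \<sigma> i > \<sigma> j}"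

definition avoids_321 :: "nat \<Rightarrow> (nat \<Rightarrow> nat) \<Rightarrow> bool" where
  "avoids_321 n \<sigma> \<longleftrightarrow>
     \<not> (\<exists>i j k. 1 \<le> i \<and> i < j \<and> j < k \<and> k \<le> n \<and> \<sigma> i > \<sigma> j \<and> \<sigma> j > \<sigma> k)"

definition B' :: "nat \<Rightarrow> (nat \<Rightarrow> nat) set" where
  "B' n = {\<sigma>. \<sigma> permutes {1..n} \<and> avoids_321 n \<sigma>}"

text \<open>\<open>Top\<close> is the new element adjoined above all elements \<open>El x\<close>.\<close>

datatype 'a with_top = El 'a | Top

fun weak_le :: "nat \<Rightarrow> (nat \<Rightarrow> nat) with_top \<Rightarrow> (nat \<Rightarrow> nat) with_top \<Rightarrow> bool" where
  "weak_le n (El \<sigma>) (El \<tau>) \<longleftrightarrow> inversions n \<sigma> \<subseteq> inversions n \<tau>"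
| "weak_le n Top (El \<tau>) \<longleftrightarrow> False"
| "weak_le n x Top \<longleftrightarrow> True"

definition B :: "nat \<Rightarrow> (nat \<Rightarrow> nat) with_top gorder" where
  "B n = \<lparr>carrier = insert Top (El ` B' n), eq = (=), le = weak_le n\<rparr>"

definition atoms :: "('a, 'b) gorder_scheme \<Rightarrow> 'a set" where
  "atoms L = {a \<in> carrier L. \<bottom>\<^bsub>L\<^esub> \<sqsubset>\<^bsub>L\<^esub> a \<and> \<not> (\<exists>x\<in>carrier L. \<bottom>\<^bsub>L\<^esub> \<sqsubset>\<^bsub>L\<^esub> x \<and> x \<sqsubset>\<^bsub>L\<^esub> a)}"

text \<open>In the next two definitions \<open>lhd\<close> is the strict part of a total order on the atoms
  of a finite lattice \<open>L\<close>.\<close>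

definition bounded_below ::
    "('a, 'b) gorder_scheme \<Rightarrow> ('a \<Rightarrow> 'a \<Rightarrow> bool) \<Rightarrow> 'a set \<Rightarrow> bool" where
  "bounded_below L lhd D \<longleftrightarrow>
     D \<noteq> {} \<and> D \<subseteq> atoms L \<and>
     (\<forall>d\<in>D. \<exists>a\<in>atoms L. lhd a d \<and> a \<sqsubset>\<^bsub>L\<^esub> \<Squnion>\<^bsub>L\<^esub>D)"

definition NBB :: "('a, 'b) gorder_scheme \<Rightarrow> ('a \<Rightarrow> 'a \<Rightarrow> bool) \<Rightarrow> 'a set \<Rightarrow> bool" where
  "NBB L lhd X \<longleftrightarrow> X \<subseteq> atoms L \<and> \<not> (\<exists>D\<subseteq>X. bounded_below L lhd D)"

definition adj_transp :: "nat \<Rightarrow> (nat \<Rightarrow> nat) with_top" where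
  "adj_transp i = El (Transposition.transpose i (i + 1))"

definition atom_less :: "nat \<Rightarrow> (nat \<Rightarrow> nat) with_top \<Rightarrow> (nat \<Rightarrow> nat) with_top \<Rightarrow> bool" where
  "atom_less n a b \<longleftrightarrow>
     (\<exists>i j. 1 \<le> i \<and> i < j \<and> j \<le> n - 1 \<and> a = adj_transp i \<and> b = adj_transp j)"

definition sparse_set :: "nat \<Rightarrow> nat set \<Rightarrow> bool" where
  "sparse_set m S \<longleftrightarrow>
     S \<subseteq> {1..m} \<and> 1 \<in> S \<and> (\<forall>i\<in>S. 1 \<le> i \<and> i \<le> m - 1 \<longrightarrow> i + 1 \<notin> S)"

end

theory Submission
  imports Defs
begin

text \<open>The join of a set of atoms is \<open>Top\<close> as soon as it contains two neighbours \<open>\<sigma>\<^sub>j, \<sigma>\<^sub>j\<^sub>+\<^sub>1\<close>,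
  because an upper bound in \<open>B'\<^sub>n\<close> would have the decreasing values \<open>\<sigma>(j) > \<sigma>(j+1) > \<sigma>(j+2)\<close>;
  otherwise it is the product of the (commuting) atoms, and the only atoms below it are its factors.
  Hence the bounded below sets are exactly those that contain two neighbours but not \<open>\<sigma>\<^sub>1\<close>, so
  \<open>X\<close> is NBB iff \<open>X - {\<sigma>\<^sub>1}\<close> contains no two neighbours. As \<open>\<Squnion>X = Top\<close> forces two neighbours in
  \<open>X\<close>, these must then be \<open>\<sigma>\<^sub>1, \<sigma>\<^sub>2\<close>.\<close>

section \<open>Recovering a permutation from its inversions\<close>

text \<open>As \<open>\<sigma>\<close> maps \<open>{1..n}\<close> onto itself, its values up to
  \<open>\<sigma> x\<close> are exactly 1, ..., \<open>\<sigma> x\<close>; so a value is its own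
  rank.\<close>

lemma permutes_eq_card:
  assumes p: "\<sigma> permutes {1..n::nat}" and x: "x \<in> {1..n}"
  shows "\<sigma> x = card {y \<in> {1..n}. \<sigma> y \<le> \<sigma> x}"
proof -
  have "\<sigma> ` {y \<in> {1..n}. \<sigma> y \<le> \<sigma> x} = {1..\<sigma> x}"
  proof -
    have "\<sigma> ` {y \<in> {1..n}. \<sigma> y \<le> \<sigma> x} = {z \<in> \<sigma> ` {1..n}. z \<le> \<sigma> x}"
      by blast
    also have "\<dots> = {1..\<sigma> x}"
      using permutes_in_image[OF p, of x] x unfolding permutes_image[OF p] by auto
    finally show ?thesis .
  qed
  moreover have "inj_on \<sigma> {y \<in> {1..n}. \<sigma> y \<le> \<sigma> x}"
    using permutes_inj[OF p] by (rule inj_on_subset) simp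
  ultimately show ?thesis
    by (metis card_atLeastAtMost card_image diff_Suc_1)
qed

text \<open>The inversions decide every comparison of two values, and the comparisons give the
  ranks, hence the values. This yields antisymmetry of the weak order.\<close>

lemma inversions_inj:
  assumes p: "\<sigma> permutes {1..n}" and q: "\<tau> permutes {1..n}"
    and eq: "inversions n \<sigma> = inversions n \<tau>"
  shows "\<sigma> = \<tau>"
proof
  have le_iff: "\<rho> y \<le> \<rho> x \<longleftrightarrow> x = y \<or> (y < x \<and> (y, x) \<notin> inversions n \<rho>)
      \<or> (x < y \<and> (x, y) \<in> inversions n \<rho>)"
    if r: "\<rho> permutes {1..n}" and "x \<in> {1..n}" "y \<in> {1..n}" for \<rho> x y
  proof -
    have "\<rho> x = \<rho> y \<longleftrightarrow> x = y" using permutes_inj[OF r] by (rule inj_eq)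
    then show ?thesis
      using that(2,3) le_less[of "\<rho> y" "\<rho> x"]
      unfolding inversions_def by (cases x y rule: linorder_cases) auto
  qed
  fix x show "\<sigma> x = \<tau> x"
  proof (cases "x \<in> {1..n}")
    case True
    have "{y \<in> {1..n}. \<sigma> y \<le> \<sigma> x} = {y \<in> {1..n}. \<tau> y \<le> \<tau> x}"
      using le_iff[OF p True] le_iff[OF q True] eq by auto
    then show ?thesis
      using permutes_eq_card[OF p True] permutes_eq_card[OF q True] by simp
  next
    case False
    then show ?thesis using permutes_not_in[OF p] permutes_not_in[OF q] by simp
  qed
qed

section \<open>The partial order on \<open>B n\<close>\<close>

lemma weak_le_Top_right [simp]: "weak_le n x Top"
  by (cases x) auto

lemma weak_le_Top_left [simp]: "weak_le n Top x \<longleftrightarrow> x = Top"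
  by (cases x) auto

lemma carrier_B: "carrier (B n) = insert Top (El ` B' n)"
  and le_B [simp]: "x \<sqsubseteq>\<^bsub>B n\<^esub> y \<longleftrightarrow> weak_le n x y"
  and eq_B [simp]: "x .=\<^bsub>B n\<^esub> y \<longleftrightarrow> x = y"
  and lless_B [simp]: "x \<sqsubset>\<^bsub>B n\<^esub> y \<longleftrightarrow> weak_le n x y \<and> x \<noteq> y"
  by (auto simp: B_def lless_def)

lemma weak_le_trans: "weak_le n x y \<Longrightarrow> weak_le n y z \<Longrightarrow> weak_le n x z"
  by (cases x; cases y; cases z) auto

lemma partial_order_B: "partial_order (B n)"
proof unfold_locales
  fix x y assume "x \<sqsubseteq>\<^bsub>B n\<^esub> y" "y \<sqsubseteq>\<^bsub>B n\<^esub> x" "x \<in> carrier (B n)" "y \<in> carrier (B n)"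
  then show "x .=\<^bsub>B n\<^esub> y"
    by (cases x; cases y) (auto simp: carrier_B B'_def intro: inversions_inj)
next
  fix x assume "x \<in> carrier (B n)" then show "x \<sqsubseteq>\<^bsub>B n\<^esub> x" by (cases x) auto
qed (auto intro: weak_le_trans simp: B_def)

text \<open>Least elements in a partial order are unique, so the choice in \<open>sup\<close> is
  determined once one least upper bound is exhibited.\<close>

lemma sup_B_eqI: "least (B n) s (Upper (B n) A) \<Longrightarrow> \<Squnion>\<^bsub>B n\<^esub>A = s"
  unfolding sup_def by (rule some_equality) (auto intro: partial_order.least_unique[OF partial_order_B])

lemma bottom_B: "\<bottom>\<^bsub>B n\<^esub> = El id"
proof -
  have "least (B n) (El id) (carrier (B n))"
  proof -
    have "El id \<sqsubseteq>\<^bsub>B n\<^esub> y" for y by (cases y) (auto simp: inversions_def)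
    then show ?thesis
      by (auto simp: least_def carrier_B B'_def permutes_id avoids_321_def)
  qed
  then show ?thesis
    unfolding bottom_def by (auto intro: partial_order.least_unique[OF partial_order_B])
qed

text \<open>If \<open>I \<subseteq> {1..}\<close> contains no two neighbours, this is the product of the commuting transpositions
  \<open>(j, j+1)\<close> with \<open>j \<in> I\<close>.\<close>

definition swaps :: "nat set \<Rightarrow> nat \<Rightarrow> nat" where
  "swaps I x = (if x \<in> I then Suc x else if x - 1 \<in> I then x - 1 else x)"

section \<open>Products of commuting adjacent transpositions\<close>

lemma adj_transp_eq_swaps:
  assumes "j \<ge> 1" shows "adj_transp j = El (swaps {j})"
  using assms by (auto simp: adj_transp_def swaps_def Transposition.transpose_def fun_eq_iff)

text \<open>The pairs {j, j+1} with j in \<open>I\<close> are disjoint, and each is reversed in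
  place, so the order of values changes only inside such a pair.\<close>

lemma inversions_swaps:
  assumes "I \<subseteq> {1..n - 1}" "\<forall>j\<in>I. Suc j \<notin> I"
  shows "inversions n (swaps I) = (\<lambda>j. (j, Suc j)) ` I"
proof -
  have "swaps I x > swaps I y \<longleftrightarrow> x \<in> I \<and> y = Suc x" if "x < y" for x y
    using that assms by (auto simp: swaps_def split: if_splits)
  moreover have "1 \<le> x \<and> Suc x \<le> n" if "x \<in> I" for x
    using that assms(1) by fastforce
  ultimately show ?thesis
    unfolding inversions_def by fastforce
qed

lemma swaps_permutes:
  assumes I: "I \<subseteq> {1..n - 1}" and sp: "\<forall>j\<in>I. Suc j \<notin> I"
  shows "swaps I permutes {1..n}"
proof -
  \<comment> \<open>This matters at x = 0, where truncated subtraction gives 0 - 1 = 0: both tests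
    in \<open>swaps\<close> then fail.\<close>
  have 0: "0 \<notin> I" using I by auto
  have out: "swaps I x = x" if "x \<notin> {1..n}" for x
    using that 0 subsetD[OF I, of x] subsetD[OF I, of "x - 1"] by (cases x) (auto simp: swaps_def)
  have inv: "swaps I (swaps I x) = x" for x
    using sp 0 by (cases x) (auto simp: swaps_def)
  show ?thesis
    \<comment> \<open>An involution takes the value y exactly once, namely at
      \<open>swaps I y\<close>.\<close>
    unfolding permutes_def using out inv by metis
qed

text \<open>A 321 pattern contains two inversions sharing their middle position, which would put two
  neighbours into \<open>I\<close>.\<close>

lemma swaps_in_B':
  assumes "I \<subseteq> {1..n - 1}" "\<forall>j\<in>I. Suc j \<notin> I"
  shows "swaps I \<in> B' n"
proof -
  have "avoids_321 n (swaps I)"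
    unfolding avoids_321_def
  proof (intro notI, elim exE conjE)
    fix i j k
    assume "1 \<le> i" "i < j" "j < k" "k \<le> n" "swaps I i > swaps I j" "swaps I j > swaps I k"
    then have "(i, j) \<in> inversions n (swaps I)" "(j, k) \<in> inversions n (swaps I)"
      by (auto simp: inversions_def)
    then show False using assms(2) by (auto simp: inversions_swaps[OF assms])
  qed
  then show ?thesis using swaps_permutes[OF assms] by (simp add: B'_def)
qed

section \<open>Adjacent transpositions as atoms\<close>

lemma inversions_swaps_singleton:
  "j \<in> {1..n - 1} \<Longrightarrow> inversions n (swaps {j}) = {(j, Suc j)}"
  using inversions_swaps[of "{j}" n] by simp

lemma adj_transp_le_El_iff:
  "j \<in> {1..n - 1} \<Longrightarrow> weak_le n (adj_transp j) (El \<tau>) \<longleftrightarrow> (j, Suc j) \<in> inversions n \<tau>"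
  by (simp add: adj_transp_eq_swaps inversions_swaps_singleton)

lemma adj_transp_eq_iff: "adj_transp i = adj_transp j \<longleftrightarrow> i = j"
  by (auto simp: adj_transp_def fun_eq_iff Transposition.transpose_def split: if_splits)

lemma adj_transp_in_carrier: "j \<in> {1..n - 1} \<Longrightarrow> adj_transp j \<in> carrier (B n)"
  using swaps_in_B'[of "{j}" n] by (simp add: adj_transp_eq_swaps carrier_B)

text \<open>There is just one inversion, so an element below has none or the same one; by
  \<open>inversions_inj\<close> it is the identity or the transposition itself.\<close>

lemma adj_transp_in_atoms:
  assumes j: "j \<in> {1..n - 1}"
  shows "adj_transp j \<in> atoms (B n)"
proof -
  have id: "inversions n id = {}" by (auto simp: inversions_def)
  have False if x: "x \<in> carrier (B n)" "El id \<noteq> x" "weak_le n x (adj_transp j)"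
      "x \<noteq> adj_transp j" for x
  proof -
    from x obtain \<tau> where \<tau>: "x = El \<tau>" "\<tau> \<in> B' n"
      using j by (auto simp: carrier_B adj_transp_eq_swaps)
    then have "inversions n \<tau> = {} \<or> inversions n \<tau> = {(j, Suc j)}"
      using x j by (auto simp: adj_transp_eq_swaps inversions_swaps_singleton)
    then have "\<tau> = id \<or> \<tau> = swaps {j}"
      using \<tau>(2) inversions_inj[of \<tau> n id] inversions_inj[of \<tau> n "swaps {j}"]
        swaps_permutes[of "{j}" n] j id permutes_id
      by (auto simp: B'_def inversions_swaps_singleton)
    then show False using x \<tau> j by (auto simp: adj_transp_eq_swaps)
  qed
  moreover have "El id \<noteq> adj_transp j"
    by (auto simp: adj_transp_def fun_eq_iff intro!: exI[of _ j])
  moreover have "weak_le n (El id) (adj_transp j)"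
    using j by (simp add: adj_transp_eq_swaps id)
  ultimately show ?thesis
    using adj_transp_in_carrier[OF j] by (auto simp: atoms_def bottom_B)
qed

section \<open>Joins of sets of atoms\<close>

lemma Upper_adj_transp:
  assumes I: "I \<subseteq> {1..n - 1}"
  shows "Upper (B n) (adj_transp ` I) =
    insert Top (El ` {\<tau> \<in> B' n. \<forall>j\<in>I. (j, Suc j) \<in> inversions n \<tau>})"
proof -
  have "adj_transp ` I \<inter> carrier (B n) = adj_transp ` I"
    using I adj_transp_in_carrier by blast
  then have "Upper (B n) (adj_transp ` I) = {u \<in> carrier (B n). \<forall>j\<in>I. weak_le n (adj_transp j) u}"
    by (auto simp: Upper_def)
  moreover have "weak_le n (adj_transp j) (El \<tau>) \<longleftrightarrow> (j, Suc j) \<in> inversions n \<tau>"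
    if "j \<in> I" for j \<tau>
    using that I adj_transp_le_El_iff by blast
  ultimately show ?thesis
    by (auto simp: carrier_B)
qed

lemma sup_neighbours:
  assumes I: "I \<subseteq> {1..n - 1}" and j: "j \<in> I" "Suc j \<in> I"
  shows "\<Squnion>\<^bsub>B n\<^esub>(adj_transp ` I) = Top"
proof -
  have "\<not> (\<forall>j\<in>I. (j, Suc j) \<in> inversions n \<tau>)" if "\<tau> \<in> B' n" for \<tau>
  proof
    assume "\<forall>j\<in>I. (j, Suc j) \<in> inversions n \<tau>"
    then have "(j, Suc j) \<in> inversions n \<tau>" "(Suc j, Suc (Suc j)) \<in> inversions n \<tau>"
      using j by blast+
    then have "\<not> avoids_321 n \<tau>"
      unfolding avoids_321_def inversions_def by blast
    then show False using that by (simp add: B'_def)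
  qed
  then have "Upper (B n) (adj_transp ` I) = {Top}"
    unfolding Upper_adj_transp[OF I] by blast
  then have "least (B n) Top (Upper (B n) (adj_transp ` I))"
    by (simp add: least_def carrier_B)
  then show ?thesis by (rule sup_B_eqI)
qed

text \<open>The inversions of \<open>swaps I\<close> are precisely those that every upper bound in
  \<open>B' n\<close> must have.\<close>

lemma sup_no_neighbours:
  assumes I: "I \<subseteq> {1..n - 1}" "\<forall>j\<in>I. Suc j \<notin> I"
  shows "\<Squnion>\<^bsub>B n\<^esub>(adj_transp ` I) = El (swaps I)"
proof (rule sup_B_eqI)
  show "least (B n) (El (swaps I)) (Upper (B n) (adj_transp ` I))"
    using swaps_in_B'[OF I]
    by (auto simp: least_def Upper_adj_transp[OF I(1)] carrier_B inversions_swaps[OF I])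
qed

section \<open>Bounded below sets and NBB sets\<close>

lemma atom_less_adj_transp:
  "atom_less n a (adj_transp j) \<longleftrightarrow> j \<le> n - 1 \<and> (\<exists>i. 1 \<le> i \<and> i < j \<and> a = adj_transp i)"
  by (auto simp: atom_less_def adj_transp_eq_iff)

text \<open>If the join is \<open>Top\<close>, every adjacent transposition lies strictly below it,
  so only the first one in the order can lack a predecessor. Without neighbours, the member of
  smallest index violates the condition.\<close>

lemma bounded_below_iff:
  assumes I: "I \<subseteq> {1..n - 1}"
  shows "bounded_below (B n) (atom_less n) (adj_transp ` I) \<longleftrightarrow> 1 \<notin> I \<and> (\<exists>j\<in>I. Suc j \<in> I)"
    (is "?bb \<longleftrightarrow> _")
proof (cases "\<exists>j\<in>I. Suc j \<in> I")
  case True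
  then have sup: "\<Squnion>\<^bsub>B n\<^esub>(adj_transp ` I) = Top" using sup_neighbours[OF I] by blast
  have "?bb \<longleftrightarrow> (\<forall>d\<in>I. \<exists>a\<in>atoms (B n). atom_less n a (adj_transp d) \<and> a \<noteq> Top)"
  proof -
    have "adj_transp ` I \<subseteq> atoms (B n)" "adj_transp ` I \<noteq> {}"
      using True I adj_transp_in_atoms by blast+
    then show ?thesis by (simp add: bounded_below_def sup)
  qed
  also have "\<dots> \<longleftrightarrow> (\<forall>d\<in>I. 1 < d)"
  proof (intro ball_cong refl iffI)
    fix d assume "d \<in> I" "1 < d"
    \<comment> \<open>The atom of index 1 serves as witness for every larger d.\<close>
    then have "1 \<in> {1..n - 1}" "d \<le> n - 1" using I by fastforce+
    moreover have "adj_transp 1 \<noteq> Top" by (simp add: adj_transp_def)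
    ultimately show "\<exists>a\<in>atoms (B n). atom_less n a (adj_transp d) \<and> a \<noteq> Top"
      using adj_transp_in_atoms[of 1 n] \<open>1 < d\<close> unfolding atom_less_adj_transp by blast
  qed (auto simp: atom_less_adj_transp)
  also have "\<dots> \<longleftrightarrow> 1 \<notin> I"
    using I by (metis atLeastAtMost_iff le_neq_implies_less less_irrefl subsetD)
  finally show ?thesis using True by blast
next
  case False
  have "\<not> ?bb"
  proof
    assume bb: ?bb
    then have "I \<noteq> {}" by (auto simp: bounded_below_def)
    then obtain m where m: "m \<in> I" "\<forall>j\<in>I. m \<le> j"
      using exists_least_iff[of "\<lambda>j. j \<in> I"] by (auto simp: not_less[symmetric])
    have sup: "\<Squnion>\<^bsub>B n\<^esub>(adj_transp ` I) = El (swaps I)"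
      using sup_no_neighbours[OF I] False by blast
    from bb m(1) obtain a where a: "atom_less n a (adj_transp m)" "weak_le n a (El (swaps I))"
      unfolding bounded_below_def sup by auto
    then obtain i where "1 \<le> i" "i < m" "m \<le> n - 1" "a = adj_transp i"
      by (auto simp: atom_less_adj_transp)
    \<comment> \<open>The atoms \<open>adj_transp i\<close> below \<open>El (swaps I)\<close> are
      its factors, so i would be an index in \<open>I\<close> smaller than the minimum m.\<close>
    then have "i \<in> I"
      using a(2) adj_transp_le_El_iff[of i n] inversions_swaps[OF I] False by auto
    then show False using m \<open>i < m\<close> by auto
  qed
  then show ?thesis using False by blast
qed

lemma NBB_iff:
  assumes I: "I \<subseteq> {1..n - 1}"
  shows "NBB (B n) (atom_less n) (adj_transp ` I) \<longleftrightarrow> (\<forall>j\<in>I. Suc j \<in> I \<longrightarrow> j = 1)"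
proof -
  have "(\<exists>D\<subseteq>adj_transp ` I. bounded_below (B n) (atom_less n) D) \<longleftrightarrow>
        (\<exists>J\<subseteq>I. bounded_below (B n) (atom_less n) (adj_transp ` J))"
    by (metis subset_imageE image_mono)
  also have "\<dots> \<longleftrightarrow> (\<exists>J\<subseteq>I. 1 \<notin> J \<and> (\<exists>j\<in>J. Suc j \<in> J))"
    using bounded_below_iff I by (metis order_trans)
  also have "\<dots> \<longleftrightarrow> (\<exists>j\<in>I. Suc j \<in> I \<and> j \<noteq> 1)"
  proof
    assume "\<exists>j\<in>I. Suc j \<in> I \<and> j \<noteq> 1"
    then obtain j where "j \<in> I" "Suc j \<in> I" "j \<noteq> 1" by blast
    moreover from this have "j \<noteq> 0" using I by auto
    ultimately show "\<exists>J\<subseteq>I. 1 \<notin> J \<and> (\<exists>j\<in>J. Suc j \<in> J)"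
      \<comment> \<open>The offending pair alone suffices; it misses 1 because j is neither 0 nor
        1.\<close>
      by (intro exI[of _ "{j, Suc j}"]) auto
  qed blast
  finally show ?thesis
    using I adj_transp_in_atoms by (auto simp: NBB_def)
qed

theorem theorem4p1:
  fixes n k :: nat
    and i :: "nat \<Rightarrow> nat"
    and X :: "(nat \<Rightarrow> nat) with_top set"
  assumes "n \<ge> 2"
    and "k \<ge> 1"
    and "\<forall>j\<in>{1..k}. 1 \<le> i j \<and> i j \<le> n - 1"
    and "strict_mono_on {1..k} i"
    and "X = (\<lambda>j. adj_transp (i j)) ` {1..k}"
    and "\<Squnion>\<^bsub>B n\<^esub>X = Top"
  shows "NBB (B n) (atom_less n) X \<longleftrightarrow>
           i 1 = 1 \<and> sparse_set (n - 2) ((\<lambda>j. i j - 1) ` {2..k})"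
proof -
  define I where "I = i ` {1..k}"
  let ?S = "(\<lambda>j. i j - 1) ` {2..k}"
  have I: "I \<subseteq> {1..n - 1}" using assms(3) by (auto simp: I_def)
  have X: "X = adj_transp ` I" using assms(5) by (auto simp: I_def)
  \<comment> \<open>Otherwise the join would be \<open>El (swaps I)\<close>, which differs from
    \<open>Top\<close>.\<close>
  have neighbours: "\<exists>j\<in>I. Suc j \<in> I"
    using sup_no_neighbours[OF I] assms(6) unfolding X by force
  have lt: "i 1 < i j" if "j \<in> {2..k}" for j
    using that by (intro strict_mono_onD[OF assms(4)]) auto
  have split: "{1..k} = insert 1 {2..k}" using assms(2) by auto
  have I_split: "I = insert (i 1) (i ` {2..k})" unfolding I_def split by simp
  have i1: "1 \<le> i 1" using assms(2,3) by simp
  \<comment> \<open>Thus \<open>?S\<close> is \<open>I\<close> without its least element, shifted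
    down by one; nothing is truncated, since \<open>i j > i 1\<close> makes \<open>i j\<close>
    positive.\<close>
  have mem_S: "s \<in> ?S \<longleftrightarrow> Suc s \<in> I \<and> Suc s \<noteq> i 1" for s
  proof -
    have "i j - 1 = s \<longleftrightarrow> i j = Suc s" if "j \<in> {2..k}" for j
      using lt[OF that] by linarith
    then have "s \<in> ?S \<longleftrightarrow> Suc s \<in> i ` {2..k}" unfolding image_iff by metis
    then show ?thesis using lt by (fastforce simp: I_split)
  qed
  have "(\<forall>j\<in>I. Suc j \<in> I \<longrightarrow> j = 1) \<longleftrightarrow> i 1 = 1 \<and> sparse_set (n - 2) ?S"
  proof
    assume *: "\<forall>j\<in>I. Suc j \<in> I \<longrightarrow> j = 1"
    with neighbours have 12: "1 \<in> I" "Suc 1 \<in> I" by auto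
    have i1': "i 1 = 1" using 12(1) lt i1 by (fastforce simp: I_split)
    have "?S \<subseteq> {1..n - 2}"
    proof
      fix s assume "s \<in> ?S"
      then have "Suc s \<in> I" "Suc s \<noteq> 1" using mem_S i1' by auto
      then show "s \<in> {1..n - 2}" using I by fastforce
    qed
    moreover have "1 \<in> ?S" using mem_S[of 1] 12 i1' by simp
    moreover have "s + 1 \<notin> ?S" if "s \<in> ?S" for s
      using * that mem_S[of s] mem_S[of "s + 1"] i1' by auto
    ultimately show "i 1 = 1 \<and> sparse_set (n - 2) ?S"
      using i1' unfolding sparse_set_def by blast
  next
    assume *: "i 1 = 1 \<and> sparse_set (n - 2) ?S"
    show "\<forall>j\<in>I. Suc j \<in> I \<longrightarrow> j = 1"
    proof (intro ballI impI, rule ccontr)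
      fix j assume j: "j \<in> I" "Suc j \<in> I" "j \<noteq> 1"
      have "1 \<le> j" "Suc j \<le> n - 1" using j I by auto
      moreover have "j - 1 \<in> ?S" "j \<in> ?S"
        using mem_S[of "j - 1"] mem_S[of j] j * \<open>1 \<le> j\<close> by auto
      \<comment> \<open>The neighbours j and j + 1 of \<open>I\<close> become j - 1 and j in
        \<open>?S\<close>; from j + 1 \<le> n - 1 follows the bound j - 1 \<le> (n - 2) - 1 that the
        sparseness condition asks for.\<close>
      ultimately have "1 \<le> j - 1" "j - 1 \<le> n - 2 - 1" "j - 1 + 1 \<in> ?S" using j(3) by auto
      then show False using * \<open>j - 1 \<in> ?S\<close> unfolding sparse_set_def by blast
    qed
  qed
  then show ?thesis unfolding X NBB_iff[OF I] .
qed

end
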